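(* Let $M,J\ge 1$ and let $x^{(l)}_k\in\mathbb{R}$, $1\le l\le J$, $0\le k\le M-1$, be not all zero, with Fourier coefficient vectors $\mathbf{a}^{(1)},\dots,\mathbf{a}^{(J)}\in\mathbb{C}^{M}$. Consider the induced linear system $\dot{\mathbf{Z}}=\mathbf{A}\mathbf{Z}+\mathbf{B}\mathbf{u}$, $\mathbf{y}=\mathbf{C}\mathbf{Z}$ with $$\mathbf{A}=\begin{bmatrix}\mathbf{\Lambda}^{-1}&&\\&\ddots&\\&&\mathbf{\Lambda}^{-1}\end{bmatrix}\in\mathbb{C}^{MJ\times MJ},\quad \mathbf{B}=\begin{bmatrix}\mathbf{e}&&\\&\ddots&\\&&\mathbf{e}\end{bmatrix}\in\mathbb{C}^{MJ\times J},$$ $$\mathbf{C}'=\begin{bmatrix}\operatorname{diag}(\mathbf{a}^{(1)})&\dots&\operatorname{diag}(\mathbf{a}^{(J)})\end{bmatrix}\in\mathbb{C}^{M\times JM},\quad \mathbf{C}=\mathbf{E}\mathbf{C}'\in\mathbb{C}^{P\times JM},$$ where $P$ is the number of non-zero rows of $\mathbf{C}'$, $\mathbf{E}\in\mathbb{C}^{P\times M}$ is the row elimination matrix deleting the zero rows of $\mathbf{C}'$, and $\operatorname{rank}\mathbf{C}=\operatorname{rank}\mathbf{C}'=P$. Let $\mu$ be the output controllability index of this system. Then $\mu-1$ is a tight upper bound on the minimal number of time delays $L\in\mathbb{N}$ for which there is a matrix $\tilde{\mathbf{K}}\in\mathbb{C}^{J(L+1)\times J}$ with $$\mathbf{C}'\left(\begin{bmatrix}\mathbf{b}&&\\&\ddots&\\&&\mathbf{b}\end{bmatrix}-\begin{bmatrix}\mathbf{A}_{L}&&\\&\ddots&\\&&\mathbf{A}_{L}\end{bmatrix}\tilde{\mathbf{K}}\right)=\mathbf{0}$$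 ($J$ diagonal blocks each), and thus on the minimal number of time delays for a perfect reconstruction of the dynamics, i.e. for the existence of $\tilde{\mathbf{K}}\in\mathbb{R}^{J(L+1)\times J}$ with $\tilde x_{(k+1)\bmod M}=\tilde{\mathbf{K}}^\top\tilde{\mathbf{Y}}_k$ for all $k\in\{0,\dots,M-1\}$. Here "tight upper bound" means that the minimal number of delays is always at most $\mu-1$ and that equality occurs for some instances of the data.
   Context: $\mathbb{N}=\{0,1,2,\dots\}$, $j=\sqrt{-1}$, $\omega=e^{-j2\pi/M}$. $x^{(l)}_k$ are $M$ uniform samples over one period of the $l$-th component of a real $J$-dimensional periodic signal; sample indices are taken modulo $M$. $\mathbf{a}^{(l)}=(a^{(l)}_0,\dots,a^{(l)}_{M-1})^\top$ with $a^{(l)}_i=\frac1M\sum_{k=0}^{M-1}x^{(l)}_k e^{j2\pi ki/M}$. $\tilde x_k=(x^{(1)}_k,\dots,x^{(J)}_k)^\top$; $\mathbf{Y}^{(l)}_k=(x^{(l)}_{k \bmod M},x^{(l)}_{(k-1)\bmod M},\dots,x^{(l)}_{(k-L)\bmod M})^\top\in\mathbb{R}^{L+1}$; $\tilde{\mathbf{Y}}_k\in\mathbb{R}^{J(L+1)}$ is the vertical stack of $\mathbf{Y}^{(1)}_k,\dots,\mathbf{Y}^{(J)}_k$. $\mathbf{\Lambda}=\operatorname{diag}(\omega^0,\dots,\omega^{M-1})$, $\mathbf{e}=(1,\dots,1)^\top\in\mathbb{C}^M$, $\mathbf{b}=(\omega^{0},\omega^{1},\dots,\omega^{M-1})^\top$,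 and $\mathbf{A}_{L}\in\mathbb{C}^{M\times(L+1)}$ has entries $(\mathbf{A}_L)_{i,l}=\omega^{-il}$, $0\le i\le M-1$, $0\le l\le L$. If the non-zero rows of $\mathbf{C}'$ have indices $\gamma_1<\dots<\gamma_P$, the row elimination matrix is $\mathbf{E}_{ij}=\delta_{\gamma_i,j}$. Output controllability: for a system $\dot{\mathbf z}=\mathbf{A}\mathbf z+\mathbf{B}\mathbf u$, $\mathbf y=\mathbf{C}\mathbf z$ with output dimension $P$, put $\mathcal{OC}(\mathbf{A},\mathbf{B},\mathbf{C};i)=[\mathbf{CB}\ \ \mathbf{CAB}\ \dots\ \mathbf{CA}^{i-1}\mathbf{B}]$. The system is output controllable iff $\mathcal{OC}(\mathbf{A},\mathbf{B},\mathbf{C};n)$ has full rank ($=P$) with $n$ the state dimension; in that case the output controllability index is the least integer $\mu$ such that $\mathcal{OC}(\mathbf{A},\mathbf{B},\mathbf{C};\mu)$ has full rank $P$. *)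

theory Defs
  imports Complex_Main "Jordan_Normal_Form.DL_Rank"
begin

text \<open>Column rank of a matrix, with the ambient dimension of the library's rank taken from the matrix.\<close>

definition mat_rank :: "complex mat \<Rightarrow> nat" where
  "mat_rank X = vec_space.rank (dim_row X) X"

text \<open>The horizontal concatenation \<open>[F 0 F 1 \<dots> F (n - 1)]\<close> of \<open>n\<close> blocks of size \<open>nr \<times> nc\<close>.\<close>

definition hconcat :: "nat \<Rightarrow> nat \<Rightarrow> nat \<Rightarrow> (nat \<Rightarrow> 'a mat) \<Rightarrow> 'a mat" where
  "hconcat nr nc n F = mat nr (nc * n) (\<lambda>(i, c). F (c div nc) $$ (i, c mod nc))"

definition block_diag :: "nat \<Rightarrow> 'a::zero mat \<Rightarrow> 'a mat" where
  "block_diag J D = diag_block_mat (replicate J D)"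


section \<open>Output controllability\<close>

definition oc_mat :: "complex mat \<Rightarrow> complex mat \<Rightarrow> complex mat \<Rightarrow> nat \<Rightarrow> complex mat" where
  "oc_mat A B C i = hconcat (dim_row C) (dim_col B) i (\<lambda>t. C * (A ^\<^sub>m t) * B)"

definition output_controllable :: "complex mat \<Rightarrow> complex mat \<Rightarrow> complex mat \<Rightarrow> bool" where
  "output_controllable A B C \<longleftrightarrow> mat_rank (oc_mat A B C (dim_row A)) = dim_row C"

text \<open>Only meaningful if the system is output controllable.\<close>

definition oc_index :: "complex mat \<Rightarrow> complex mat \<Rightarrow> complex mat \<Rightarrow> nat" where
  "oc_index A B C = (LEAST \<mu>. mat_rank (oc_mat A B C \<mu>) = dim_row C)"


section \<open>Row elimination\<close>

definition nonzero_rows :: "complex mat \<Rightarrow> nat list" where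
  "nonzero_rows X = filter (\<lambda>i. row X i \<noteq> 0\<^sub>v (dim_col X)) [0..<dim_row X]"

definition row_elim :: "complex mat \<Rightarrow> complex mat" where
  "row_elim X = mat (length (nonzero_rows X)) (dim_row X)
     (\<lambda>(i, j). if nonzero_rows X ! i = j then 1 else 0)"


section \<open>The system induced by a sampled periodic signal\<close>

text \<open>
  A signal is a function \<open>x :: nat \<Rightarrow> nat \<Rightarrow> real\<close>, where \<open>x l k\<close> is sample \<open>k < M\<close> of
  component \<open>l < J\<close> (components are counted from 0). Values of \<open>x\<close> outside this range are never used.
\<close>

definition nonzero_signal :: "nat \<Rightarrow> nat \<Rightarrow> (nat \<Rightarrow> nat \<Rightarrow> real) \<Rightarrow> bool" where
  "nonzero_signal M J x \<longleftrightarrow> (\<exists>l<J. \<exists>k<M. x l k \<noteq> 0)"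

definition omega :: "nat \<Rightarrow> complex" where
  "omega M = exp (- \<i> * 2 * of_real pi / of_nat M)"

definition fourier_coeff :: "nat \<Rightarrow> (nat \<Rightarrow> nat \<Rightarrow> real) \<Rightarrow> nat \<Rightarrow> nat \<Rightarrow> complex" where
  "fourier_coeff M x l i =
     1 / of_nat M * (\<Sum>k<M. of_real (x l k) * exp (\<i> * 2 * of_real pi * of_nat k * of_nat i / of_nat M))"

definition Lambda :: "nat \<Rightarrow> complex mat" where
  "Lambda M = mat_diag M (\<lambda>i. omega M ^ i)"

definition Lambda_inv :: "nat \<Rightarrow> complex mat" where
  "Lambda_inv M = mat_diag M (\<lambda>i. inverse (omega M ^ i))"

lemma Lambda_inv:
  "inverts_mat (Lambda M) (Lambda_inv M)" "inverts_mat (Lambda_inv M) (Lambda M)"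
proof -
  have "omega M ^ i \<noteq> 0" for i by (simp add: omega_def)
  then have "mat_diag M (\<lambda>i. omega M ^ i * inverse (omega M ^ i)) = 1\<^sub>m M"
    and "mat_diag M (\<lambda>i. inverse (omega M ^ i) * omega M ^ i) = 1\<^sub>m M"
    by (auto simp: mat_diag_def)
  then show "inverts_mat (Lambda M) (Lambda_inv M)" "inverts_mat (Lambda_inv M) (Lambda M)"
    by (simp_all add: inverts_mat_def Lambda_def Lambda_inv_def mat_diag_diag mat_diag_dim[THEN carrier_matD(1)])
qed

definition e_col :: "nat \<Rightarrow> complex mat" where
  "e_col M = mat M 1 (\<lambda>_. 1)"

definition b_col :: "nat \<Rightarrow> complex mat" where
  "b_col M = mat M 1 (\<lambda>(i, _). omega M ^ i)"

definition A_delay :: "nat \<Rightarrow> nat \<Rightarrow> complex mat" where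
  "A_delay M L = mat M (L + 1) (\<lambda>(i, l). omega M powi (- int (i * l)))"

definition sys_A :: "nat \<Rightarrow> nat \<Rightarrow> complex mat" where
  "sys_A M J = block_diag J (Lambda_inv M)"

definition sys_B :: "nat \<Rightarrow> nat \<Rightarrow> complex mat" where
  "sys_B M J = block_diag J (e_col M)"

definition sys_C' :: "nat \<Rightarrow> nat \<Rightarrow> (nat \<Rightarrow> nat \<Rightarrow> real) \<Rightarrow> complex mat" where
  "sys_C' M J x = hconcat M M J (\<lambda>l. mat_diag M (fourier_coeff M x l))"

definition sys_C :: "nat \<Rightarrow> nat \<Rightarrow> (nat \<Rightarrow> nat \<Rightarrow> real) \<Rightarrow> complex mat" where
  "sys_C M J x = row_elim (sys_C' M J x) * sys_C' M J x"

definition sys_index :: "nat \<Rightarrow> nat \<Rightarrow> (nat \<Rightarrow> nat \<Rightarrow> real) \<Rightarrow> nat" where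
  "sys_index M J x = oc_index (sys_A M J) (sys_B M J) (sys_C M J x)"


section \<open>Time delays\<close>

definition spectral_solvable :: "nat \<Rightarrow> nat \<Rightarrow> (nat \<Rightarrow> nat \<Rightarrow> real) \<Rightarrow> nat \<Rightarrow> bool" where
  "spectral_solvable M J x L \<longleftrightarrow>
     (\<exists>K \<in> carrier_mat (J * (L + 1)) J.
        sys_C' M J x * (block_diag J (b_col M) - block_diag J (A_delay M L) * K) = 0\<^sub>m M J)"

definition sample_vec :: "nat \<Rightarrow> (nat \<Rightarrow> nat \<Rightarrow> real) \<Rightarrow> nat \<Rightarrow> real vec" where
  "sample_vec J x k = vec J (\<lambda>l. x l k)"

text \<open>The index \<open>(k - d) mod M\<close> is computed on integers, since \<open>d > k\<close> is possible.\<close>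

definition delay_vec :: "nat \<Rightarrow> nat \<Rightarrow> (nat \<Rightarrow> nat \<Rightarrow> real) \<Rightarrow> nat \<Rightarrow> nat \<Rightarrow> real vec" where
  "delay_vec M L x l k = vec (L + 1) (\<lambda>d. x l (nat ((int k - int d) mod int M)))"

definition stacked_delay_vec :: "nat \<Rightarrow> nat \<Rightarrow> nat \<Rightarrow> (nat \<Rightarrow> nat \<Rightarrow> real) \<Rightarrow> nat \<Rightarrow> real vec" where
  "stacked_delay_vec M J L x k =
     vec (J * (L + 1)) (\<lambda>r. delay_vec M L x (r div (L + 1)) k $ (r mod (L + 1)))"

definition perfect_reconstruction :: "nat \<Rightarrow> nat \<Rightarrow> (nat \<Rightarrow> nat \<Rightarrow> real) \<Rightarrow> nat \<Rightarrow> bool" where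
  "perfect_reconstruction M J x L \<longleftrightarrow>
     (\<exists>K \<in> carrier_mat (J * (L + 1)) J. \<forall>k<M.
        sample_vec J x ((k + 1) mod M) = transpose_mat K *\<^sub>v stacked_delay_vec M J L x k)"

text \<open>Only meaningful if some number of delays is feasible.\<close>

definition min_delays :: "(nat \<Rightarrow> bool) \<Rightarrow> nat" where
  "min_delays feasible = (LEAST L. feasible L)"

end

theory Submission
  imports Defs "HOL-Number_Theory.Cong"
begin

text \<open>
  The entry of the output controllability matrix in the row of frequency \<open>i\<close> and in column \<open>l\<close> of
  block \<open>t\<close> is \<open>a\<^sup>l\<^sub>i \<omega>\<^sup>-\<^sup>i\<^sup>t\<close>, so up to a permutation of columns it is the coefficient matrix of the
  spectral equation with one delay per block. Full row rank therefore makes that equation solvable;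
  it holds for \<open>M\<close> blocks since the rows \<open>(\<omega>\<^sup>-\<^sup>i\<^sup>t)\<^sub>t\<close> are orthogonal, whence \<open>\<mu> \<le> M\<close>.
  The discrete Fourier transform turns the spectral equation into the delay recurrence for the
  samples, and real parts of a complex solution solve the latter. The bound is attained by
  a unit impulse in one component, which no recurrence with fewer than \<open>M - 1\<close> delays reproduces.
\<close>

section \<open>Block matrices and rank\<close>

text \<open>Division with remainder cuts \<open>{..<a * b}\<close> into \<open>a\<close> consecutive
  runs of length \<open>b\<close>. Every matrix product below becomes a double sum over blocks and
  offsets in this way.\<close>

lemma sum_div_mod:
  fixes f :: "nat \<Rightarrow> nat \<Rightarrow> 'a::comm_monoid_add"
  shows "(\<Sum>c<a * b. f (c div b) (c mod b)) = (\<Sum>i<a. \<Sum>j<b. f i j)"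
proof -
  have "(\<Sum>c<a * b. f (c div b) (c mod b)) = (\<Sum>i<a. \<Sum>c = i * b..<i * b + b. f (c div b) (c mod b))"
    by (rule sum.nat_group[symmetric])
  also have "\<dots> = (\<Sum>i<a. \<Sum>j<b. f i j)"
  proof (rule sum.cong[OF refl])
    fix i
    have "(\<Sum>c = i * b..<i * b + b. f (c div b) (c mod b)) = (\<Sum>j<b. f ((j + i * b) div b) ((j + i * b) mod b))"
      using sum.shift_bounds_nat_ivl[of "\<lambda>c. f (c div b) (c mod b)" 0 "i * b" b]
      by (simp add: add.commute lessThan_atLeast0)
    then show "(\<Sum>c = i * b..<i * b + b. f (c div b) (c mod b)) = (\<Sum>j<b. f i j)"
      by simp
  qed
  finally show ?thesis .
qed

lemma mod_less_of_less_mult: "c < a * b \<Longrightarrow> c mod b < b" for a b c :: nat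
  by (cases "b = 0") auto

lemma block_index_less:
  fixes i j a b :: nat
  assumes "i < a" "j < b"
  shows "i * b + j < a * b"
proof -
  have "Suc i * b \<le> a * b"
    using assms(1) by (intro mult_right_mono) auto
  then show ?thesis
    using assms(2) by simp
qed

text \<open>Packs a family of coefficients into a gain matrix whose row \<open>i * b + j\<close>
  belongs to delay \<open>j\<close> of component \<open>i\<close>; it supplies the matrix in both
  solvability equivalences.\<close>

lemma ex_mat_of_blocks:
  "\<exists>X \<in> carrier_mat (a * b) c. \<forall>i<a. \<forall>j<b. \<forall>m<c. X $$ (i * b + j, m) = f i j m"
proof (intro bexI allI impI)
  let ?X = "mat (a * b) c (\<lambda>(r, m). f (r div b) (r mod b) m)"
  show "?X \<in> carrier_mat (a * b) c"
    by simp
  fix i j m assume "i < a" "j < b" "m < c"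
  then show "?X $$ (i * b + j, m) = f i j m"
    by (simp add: block_index_less)
qed

section \<open>Block-diagonal and concatenated matrices\<close>

lemma block_diag_dim [simp]:
  "dim_row (block_diag J D) = J * dim_row D" "dim_col (block_diag J D) = J * dim_col D"
  by (simp_all add: block_diag_def dim_diag_block_mat sum_list_replicate)

lemma block_diag_index:
  assumes "i < J * dim_row D" "j < J * dim_col D"
  shows "block_diag J D $$ (i, j) =
    (if i div dim_row D = j div dim_col D then D $$ (i mod dim_row D, j mod dim_col D) else 0)"
  using assms
proof (induction J arbitrary: i j)
  case (Suc J)
  have rec: "block_diag (Suc J) D = four_block_mat D (0\<^sub>m (dim_row D) (dim_col (block_diag J D)))
      (0\<^sub>m (dim_row (block_diag J D)) (dim_col D)) (block_diag J D)"
    by (simp add: block_diag_def Let_def)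
  \<comment> \<open>If a dimension of \<open>D\<close> were 0, there would be no index pair in
    range; positivity is what licenses the \<open>div\<close> and \<open>mod\<close> rules for
    peeling off the first block.\<close>
  have pos: "0 < dim_row D" "0 < dim_col D"
    using Suc.prems by (auto intro: gr0I)
  show ?case
    using Suc.prems Suc.IH[of "i - dim_row D" "j - dim_col D"] pos
    unfolding rec by (auto simp: le_div_geq le_mod_geq)
qed simp

lemma hconcat_dim [simp]:
  "dim_row (hconcat nr nc n F) = nr" "dim_col (hconcat nr nc n F) = nc * n"
  by (simp_all add: hconcat_def)

lemma hconcat_index:
  "i < nr \<Longrightarrow> c < nc * n \<Longrightarrow> hconcat nr nc n F $$ (i, c) = F (c div nc) $$ (i, c mod nc)"
  by (simp add: hconcat_def)

text \<open>Column \<open>c\<close> of the block-diagonal factor is supported in block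
  \<open>c div k\<close> only, so the sum over blocks collapses to the single product
  \<open>F (c div k) * D\<close>.\<close>

lemma hconcat_mult_block_diag:
  assumes F: "\<And>l. l < J \<Longrightarrow> F l \<in> carrier_mat nr m" and D: "D \<in> carrier_mat m k"
  shows "hconcat nr m J F * block_diag J D = hconcat nr k J (\<lambda>l. F l * D)" (is "?L = ?R")
proof (rule eq_matI)
  show "dim_row ?L = dim_row ?R" "dim_col ?L = dim_col ?R"
    using D by (auto simp: mult.commute)
  fix i c assume "i < dim_row ?R" "c < dim_col ?R"
  then have i: "i < nr" and c: "c < J * k"
    by (auto simp: mult.commute)
  define q where "q = c div k"
  have q: "q < J" and ck: "c mod k < k"
    unfolding q_def using c by (auto intro: less_mult_imp_div_less mod_less_of_less_mult)
  have "?L $$ (i, c) = (\<Sum>r<J * m. F (r div m) $$ (i, r mod m) *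
      (if r div m = q then D $$ (r mod m, c mod k) else 0))"
    using i c D by (auto simp: scalar_prod_def lessThan_atLeast0 hconcat_index block_diag_index
        mult.commute[of m] q_def intro!: sum.cong)
  also have "\<dots> = (\<Sum>l<J. \<Sum>j<m. F l $$ (i, j) * (if l = q then D $$ (j, c mod k) else 0))"
    by (rule sum_div_mod)
  also have "\<dots> = (\<Sum>l<J. if l = q then (\<Sum>j<m. F l $$ (i, j) * D $$ (j, c mod k)) else 0)"
    by (rule sum.cong) auto
  also have "\<dots> = (F q * D) $$ (i, c mod k)"
    using q i ck F[OF q] D by (auto simp: scalar_prod_def lessThan_atLeast0)
  also have "\<dots> = ?R $$ (i, c)"
    using i c by (simp add: hconcat_index q_def mult.commute)
  finally show "?L $$ (i, c) = ?R $$ (i, c)" .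
qed

lemma minus_mat_eq_zero_iff:
  fixes X Y :: "'a::group_add mat"
  assumes "X \<in> carrier_mat nr nc" "Y \<in> carrier_mat nr nc"
  shows "X - Y = 0\<^sub>m nr nc \<longleftrightarrow> (\<forall>i<nr. \<forall>j<nc. X $$ (i, j) = Y $$ (i, j))"
  using assms by (auto simp: mat_eq_iff)

lemma mat_diag_pow: "mat_diag n f ^\<^sub>m t = mat_diag n (\<lambda>i. f i ^ t)"
  for f :: "nat \<Rightarrow> 'a::comm_semiring_1"
proof (induction t)
  case 0
  have "mat_diag n (\<lambda>i. f i ^ 0) = 1\<^sub>m n"
    by simp
  then show ?case
    by (simp add: mat_diag_dim[THEN carrier_matD(1)])
qed (simp add: mult.commute)

lemma block_diag_pow:
  assumes "D \<in> carrier_mat m m"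
  shows "block_diag J D ^\<^sub>m t = block_diag J (D ^\<^sub>m t)"
  unfolding block_diag_def using assms
  by (subst diag_block_pow_mat) (auto simp: map_replicate)

lemma row_elim_dim [simp]:
  "dim_row (row_elim X) = length (nonzero_rows X)" "dim_col (row_elim X) = dim_row X"
  by (simp_all add: row_elim_def)

lemma row_elim_mult_index:
  assumes "Y \<in> carrier_mat (dim_row X) nc" "p < length (nonzero_rows X)" "c < nc"
  shows "(row_elim X * Y) $$ (p, c) = Y $$ (nonzero_rows X ! p, c)"
proof -
  have "nonzero_rows X ! p < dim_row X"
    using nth_mem[OF assms(2)] by (auto simp: nonzero_rows_def)
  then have "(\<Sum>i = 0..<dim_row X. (if nonzero_rows X ! p = i then 1 else 0) * Y $$ (i, c)) =
      Y $$ (nonzero_rows X ! p, c)"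
    by (simp add: if_distrib if_distribR cong: if_cong)
  then show ?thesis
    using assms by (simp add: scalar_prod_def row_elim_def)
qed

lemma distinct_nonzero_rows: "distinct (nonzero_rows X)"
  by (simp add: nonzero_rows_def)

section \<open>Rank and the column space\<close>

text \<open>The column space equals the span of the unit vectors indexed by \<open>S\<close>:
  \<open>zero\<close> puts every column into that span, and \<open>unit\<close> puts every such
  vector into the image. Taking \<open>S\<close> to be all rows gives a full-rank criterion; a
  proper subset handles matrices with zero rows.\<close>

lemma rank_eq_card:
  assumes X: "X \<in> carrier_mat nr nc" and S: "S \<subseteq> {..<nr}"
    and zero: "\<And>i c. i < nr \<Longrightarrow> i \<notin> S \<Longrightarrow> c < nc \<Longrightarrow> X $$ (i, c) = 0"
    and unit: "\<And>i. i \<in> S \<Longrightarrow> \<exists>k \<in> carrier_vec nc. X *\<^sub>v k = unit_vec nr i"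
  shows "mat_rank X = card S"
proof -
  interpret vec_space "TYPE(complex)" nr .
  define U where "U = (unit_vec nr ` S :: complex vec set)"
  have fin: "finite S" using S finite_subset by blast
  have inj: "inj_on (unit_vec nr :: nat \<Rightarrow> complex vec) S"
    using S by (intro inj_onI) (metis index_unit_vec(1) lessThan_iff subsetD zero_neq_one)
  have U: "U \<subseteq> carrier_vec nr" and finU: "finite U"
    using fin by (auto simp: U_def)
  have "U \<subseteq> set (unit_vecs nr)"
    using S by (auto simp: U_def unit_vecs_def)
  then have li: "lin_indpt U"
    using unit_vecs_basis unfolding basis_def by (metis subset_li_is_li)
  have cols: "set (cols X) \<subseteq> carrier_vec nr"
    using X cols_dim by blast
  have "v \<in> span U" if v_col: "v \<in> set (cols X)" for v
  proof -
    obtain c where c: "c < nc" "v = col X c"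
      using v_col X by (auto simp: in_set_conv_nth)
    have v: "v \<in> carrier_vec nr" using v_col cols by auto
    \<comment> \<open>The coordinates of \<open>v\<close> along unit vectors are its scalar products
      with them; the coordinates outside \<open>S\<close> vanish by \<open>zero\<close>.\<close>
    have "v = lincomb (\<lambda>u. u \<bullet> v) U"
    proof (rule eq_vecI)
      show "dim_vec v = dim_vec (lincomb (\<lambda>u. u \<bullet> v) U)"
        using v U finU by (simp add: lincomb_dim)
      fix i assume "i < dim_vec (lincomb (\<lambda>u. u \<bullet> v) U)"
      then have i: "i < nr" using U finU by (simp add: lincomb_dim)
      have "lincomb (\<lambda>u. u \<bullet> v) U $ i = (\<Sum>u\<in>U. u \<bullet> v * u $ i)"
        using i U by (rule lincomb_index)
      also have "\<dots> = (\<Sum>j\<in>S. (unit_vec nr j \<bullet> v) * unit_vec nr j $ i)"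
        unfolding U_def by (simp add: sum.reindex[OF inj])
      also have "\<dots> = (\<Sum>j\<in>S. if j = i then v $ i else 0)"
        using S v i by (intro sum.cong) (auto simp: scalar_prod_left_unit)
      also have "\<dots> = v $ i"
        using fin zero[OF i _ c(1)] c i X by auto
      finally show "v $ i = lincomb (\<lambda>u. u \<bullet> v) U $ i" by simp
    qed
    then show ?thesis
      using U finU by (auto simp: finite_span)
  qed
  moreover have "u \<in> span (set (cols X))" if u: "u \<in> U" for u
  proof -
    obtain i k where "i \<in> S" "u = unit_vec nr i" "k \<in> carrier_vec nc" "X *\<^sub>v k = u"
      using u unit unfolding U_def by blast
    then show ?thesis
      using col_space_eq[OF X] X unfolding col_space_def by auto
  qed
  ultimately have "span (set (cols X)) = span U"
    using U cols by (intro equalityI span_subsetI subsetI) auto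
  moreover have "vectorspace.dim class_ring (span_vs U) = card U"
    using U finU li by (intro dim_span) (auto simp: maximal_def)
  ultimately have "rank X = card U"
    by (simp add: rank_def)
  then show ?thesis
    using X inj by (simp add: mat_rank_def U_def card_image)
qed

text \<open>A maximal independent set of columns has \<open>nr\<close> elements, hence is a basis of
  the whole space, so the columns span every right-hand side.\<close>

lemma full_row_rank_imp_solvable:
  assumes X: "X \<in> carrier_mat nr nc" and rank: "mat_rank X = nr" and v: "v \<in> carrier_vec nr"
  shows "\<exists>k \<in> carrier_vec nc. X *\<^sub>v k = v"
proof -
  interpret vec_space "TYPE(complex)" nr .
  have cols: "set (cols X) \<subseteq> carrier_vec nr"
    using X cols_dim by blast
  \<comment> \<open>The empty set is the independent subset that gets extended to a maximal
    one.\<close>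
  have "lin_indpt {}"
    using unit_vecs_basis unfolding basis_def by (metis subset_li_is_li empty_subsetI)
  then obtain U where U: "maximal U (\<lambda>T. T \<subseteq> set (cols X) \<and> lin_indpt T)" "finite U"
    using maximal_exists_superset[of "set (cols X)" "\<lambda>T. T \<subseteq> set (cols X) \<and> lin_indpt T" "{}"] by auto
  then have sub: "U \<subseteq> set (cols X)" and li: "lin_indpt U"
    by (auto simp: maximal_def)
  have "card U = nr"
    using rank_card_indpt[OF X U(1)] rank X by (simp add: mat_rank_def)
  then have "basis U"
    using dim_li_is_basis[of U] U(2) sub cols li by (auto simp: dim_is_n)
  then have "span U = carrier_vec nr"
    by (simp add: basis_def)
  then have "v \<in> span (set (cols X))"
    using v sub span_is_monotone by blast
  then show ?thesis
    using col_space_eq[OF X] X unfolding col_space_def by auto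
qed


section \<open>Discrete Fourier transform\<close>

lemma omega_power: "omega M ^ i = inverse (cis (2 * pi * real i / real M))"
proof -
  have "omega M = cis (- (2 * pi / real M))"
    by (simp add: omega_def cis_conv_exp mult.assoc)
  then show ?thesis
    by (simp add: DeMoivre mult_ac)
qed

lemma omega_nonzero [simp]: "omega M \<noteq> 0"
  by (simp add: omega_def)

lemma omega_power_power_M:
  assumes "M > 0"
  shows "(omega M ^ i) ^ M = 1"
proof -
  have "(cis (2 * pi * real i / real M)) ^ M = cis (2 * pi * real i)"
    using assms by (simp add: DeMoivre)
  also have "\<dots> = 1"
    by (metis cis_multiple_2pi Ints_of_nat)
  finally show ?thesis
    by (simp add: omega_power power_inverse del: cis_inverse)
qed

lemma omega_power_inj:
  assumes "i < M" "j < M" "omega M ^ i = omega M ^ j"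
  shows "i = j"
proof -
  have "inj_on (\<lambda>k. cis (2 * pi * real k / real M)) {..<M}"
    using bij_betw_roots_unity[of M] assms by (auto simp: bij_betw_def)
  then show ?thesis
    using assms by (auto simp: omega_power simp del: cis_inverse dest: inj_onD)
qed

text \<open>A geometric sum whose ratio is an \<open>M\<close>-th root of unity, and this ratio is 1
  only for \<open>i = j\<close>.\<close>

lemma roots_of_unity_orthogonal:
  assumes "i < M" "j < M"
  shows "(\<Sum>t<M. inverse (omega M ^ i) ^ t * (omega M ^ j) ^ t) = (if i = j then of_nat M else 0)"
proof -
  let ?z = "inverse (omega M ^ i) * omega M ^ j"
  have "?z ^ M = 1"
    using assms by (simp add: power_mult_distrib power_inverse omega_power_power_M)
  moreover have "?z = 1 \<longleftrightarrow> i = j"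
    using omega_power_inj[OF assms] by (auto simp: field_simps)
  ultimately show ?thesis
    using geometric_sum[of ?z M] by (auto simp flip: power_mult_distrib)
qed

section \<open>The transform and its inversion\<close>

text \<open>The sign and normalisation are those of \<open>fourier_coeff\<close>. The argument is a
  complex sequence because the transform is also applied to combinations of samples with complex
  gains.\<close>

definition dft :: "nat \<Rightarrow> (nat \<Rightarrow> complex) \<Rightarrow> nat \<Rightarrow> complex" where
  "dft M y i = 1 / of_nat M * (\<Sum>k<M. y k * inverse (omega M ^ i) ^ k)"

lemma fourier_coeff_eq_dft: "fourier_coeff M x l = dft M (\<lambda>k. of_real (x l k))"
proof -
  have "exp (\<i> * 2 * of_real pi * of_nat k * of_nat i / of_nat M) = inverse (omega M ^ i) ^ k" for k i
    by (simp add: omega_power cis_conv_exp mult_ac flip: exp_of_nat_mult)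
  then show ?thesis
    by (simp add: fun_eq_iff fourier_coeff_def dft_def)
qed

lemma dft_cong: "(\<And>k. k < M \<Longrightarrow> y k = z k) \<Longrightarrow> dft M y = dft M z"
  by (auto simp: dft_def fun_eq_iff)

lemma dft_sum: "dft M (\<lambda>k. \<Sum>c\<in>A. f c * y c k) i = (\<Sum>c\<in>A. f c * dft M (y c) i)"
  unfolding dft_def
  by (simp add: sum_distrib_left sum_distrib_right mult_ac sum.swap[of _ A])

lemma inverse_dft:
  assumes "m < M"
  shows "(\<Sum>i<M. dft M y i * (omega M ^ m) ^ i) = y m"
proof -
  \<comment> \<open>The kernel is symmetric in frequency and time, so it can be read as a power of
    \<open>omega M ^ k\<close>; orthogonality then applies with the sample indices \<open>k\<close>
    and \<open>m\<close> as its two frequencies.\<close>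
  have "(\<Sum>i<M. dft M y i * (omega M ^ m) ^ i) =
      1 / of_nat M * (\<Sum>i<M. \<Sum>k<M. y k * (inverse (omega M ^ k) ^ i * (omega M ^ m) ^ i))"
    by (simp add: dft_def sum_distrib_left sum_distrib_right mult_ac power_inverse flip: power_mult)
  also have "\<dots> = 1 / of_nat M * (\<Sum>k<M. y k * (\<Sum>i<M. inverse (omega M ^ k) ^ i * (omega M ^ m) ^ i))"
    by (subst sum.swap) (simp add: sum_distrib_left)
  also have "\<dots> = 1 / of_nat M * (\<Sum>k<M. if k = m then y k * of_nat M else 0)"
    using assms by (intro arg_cong2[where f = "(*)"] sum.cong) (auto simp: roots_of_unity_orthogonal)
  also have "\<dots> = y m"
    using assms by simp
  finally show ?thesis .
qed

text \<open>Injectivity from the inversion formula: equations may be checked on frequencies or on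
  samples alike.\<close>

lemma dft_eq_iff: "(\<forall>i<M. dft M y i = dft M z i) \<longleftrightarrow> (\<forall>k<M. y k = z k)"
  using inverse_dft[of _ M y] inverse_dft[of _ M z] dft_cong[of M y z] by (metis (no_types, lifting) lessThan_iff sum.cong)

section \<open>Cyclic shifts\<close>

text \<open>A cyclic shift is an injective self-map of the finite set \<open>{..<M}\<close>, hence a
  permutation of it.\<close>

lemma sum_rotate:
  fixes g :: "nat \<Rightarrow> 'a::comm_monoid_add"
  shows "(\<Sum>k<M. g ((k + d) mod M)) = (\<Sum>k<M. g k)"
proof -
  have inj: "inj_on (\<lambda>k. (k + d) mod M) {..<M}"
  proof (rule inj_onI)
    fix a b assume ab: "a \<in> {..<M}" "b \<in> {..<M}" "(a + d) mod M = (b + d) mod M"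
    then have "a mod M = b mod M"
      using cong_add_rcancel_nat[of a d b M] by (simp add: cong_def)
    then show "a = b" using ab by simp
  qed
  moreover have "(\<lambda>k. (k + d) mod M) ` {..<M} \<subseteq> {..<M}"
    by (cases "M = 0") auto
  ultimately have "(\<lambda>k. (k + d) mod M) ` {..<M} = {..<M}"
    by (intro endo_inj_surj) auto
  then show ?thesis
    using sum.reindex[OF inj, of g] by simp
qed

lemma inverse_omega_power_mod:
  assumes "M > 0"
  shows "inverse (omega M ^ i) ^ (k mod M) = inverse (omega M ^ i) ^ k"
proof -
  have "inverse (omega M ^ i) ^ (M * (k div M) + k mod M) = inverse (omega M ^ i) ^ (k mod M)"
    unfolding power_add power_mult using assms by (simp add: power_inverse omega_power_power_M)
  then show ?thesis by simp
qed

text \<open>Since the kernel has period \<open>M\<close> in time, it can be shifted together with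
  the sequence. Keeping the factor on the left serves both directions: the successor is the case
  \<open>d = 1\<close>, and a delay comes from applying the rule to the delayed sequence.\<close>

lemma dft_rotate:
  assumes "M > 0"
  shows "inverse (omega M ^ i) ^ d * dft M (\<lambda>k. y ((k + d) mod M)) i = dft M y i"
proof -
  have "inverse (omega M ^ i) ^ d * dft M (\<lambda>k. y ((k + d) mod M)) i =
      1 / of_nat M * (\<Sum>k<M. y ((k + d) mod M) * inverse (omega M ^ i) ^ ((k + d) mod M))"
    using assms by (simp add: dft_def inverse_omega_power_mod power_add sum_distrib_left mult_ac)
  then show ?thesis
    by (simp add: dft_def sum_rotate[of "\<lambda>k. y k * inverse (omega M ^ i) ^ k"])
qed

lemma dft_successor:
  assumes "M > 0"
  shows "dft M (\<lambda>k. y ((k + 1) mod M)) i = omega M ^ i * dft M y i"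
  using dft_rotate[OF assms, of i 1 y] by (simp add: field_simps)

lemma dft_delay:
  assumes "M > 0"
  shows "dft M (\<lambda>k. y (nat ((int k - int d) mod int M))) i = inverse (omega M ^ i) ^ d * dft M y i"
proof -
  let ?y = "\<lambda>k. y (nat ((int k - int d) mod int M))"
  \<comment> \<open>Advancing the delayed sequence by \<open>d\<close> restores
    \<open>y\<close>.\<close>
  have "(int ((k + d) mod M) - int d) mod int M = int k mod int M" for k
    by (simp add: zmod_int mod_diff_left_eq)
  then have "dft M (\<lambda>k. ?y ((k + d) mod M)) = dft M y"
    by (intro dft_cong) (simp flip: zmod_int)
  then show ?thesis
    using dft_rotate[OF assms, of i d ?y] by simp
qed


section \<open>The output controllability matrix\<close>

lemma Lambda_inv_carrier [simp]: "Lambda_inv M \<in> carrier_mat M M"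
  by (simp add: Lambda_inv_def)

lemma e_col_carrier [simp]: "e_col M \<in> carrier_mat M 1"
  by (simp add: e_col_def)

lemma e_col_index: "i < M \<Longrightarrow> e_col M $$ (i, 0) = 1"
  by (simp add: e_col_def)

lemma b_col_carrier [simp]: "b_col M \<in> carrier_mat M 1"
  by (simp add: b_col_def)

lemma A_delay_carrier [simp]: "A_delay M L \<in> carrier_mat M (L + 1)"
  by (simp add: A_delay_def)

lemma A_delay_index:
  assumes "i < M" "d < L + 1"
  shows "A_delay M L $$ (i, d) = inverse (omega M ^ i) ^ d"
proof -
  have "omega M powi (- int (i * d)) = inverse (omega M ^ (i * d))"
    by (simp only: power_int_minus power_int_of_nat)
  then show ?thesis
    using assms unfolding A_delay_def by (simp add: power_mult power_inverse)
qed

lemma block_diag_carrier: "D \<in> carrier_mat m k \<Longrightarrow> block_diag J D \<in> carrier_mat (J * m) (J * k)"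
  by (intro carrier_matI) auto

lemma sys_A_carrier: "sys_A M J \<in> carrier_mat (J * M) (J * M)"
  by (simp add: sys_A_def block_diag_carrier)

lemma sys_B_carrier: "sys_B M J \<in> carrier_mat (J * M) J"
  using block_diag_carrier[OF e_col_carrier] by (simp add: sys_B_def)

lemma sys_C'_carrier: "sys_C' M J x \<in> carrier_mat M (J * M)"
  by (intro carrier_matI) (auto simp: sys_C'_def)

lemma sys_C_carrier: "sys_C M J x \<in> carrier_mat (length (nonzero_rows (sys_C' M J x))) (J * M)"
  using sys_C'_carrier[of M J x] by (intro carrier_matI) (auto simp: sys_C_def)

lemma sys_C'_index:
  "i < M \<Longrightarrow> c < J * M \<Longrightarrow>
    sys_C' M J x $$ (i, c) = (if c mod M = i then fourier_coeff M x (c div M) i else 0)"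
  by (auto simp: sys_C'_def hconcat_index mult.commute mat_diag_def mod_less_of_less_mult)

lemma sys_C'_mult_block_diag_index:
  assumes "D \<in> carrier_mat M k" "i < M" "c < J * k"
  shows "(sys_C' M J x * block_diag J D) $$ (i, c) = fourier_coeff M x (c div k) i * D $$ (i, c mod k)"
proof -
  have "c mod k < k"
    using assms(3) by (rule mod_less_of_less_mult)
  then show ?thesis
    using assms unfolding sys_C'_def
    by (subst hconcat_mult_block_diag[of _ _ _ M _ k]) (auto simp: hconcat_index mult.commute mat_diag_mult_left)
qed

lemma nonzero_rows_sys_C':
  "set (nonzero_rows (sys_C' M J x)) = {i. i < M \<and> (\<exists>l<J. fourier_coeff M x l i \<noteq> 0)}"
proof -
  have "row (sys_C' M J x) i = 0\<^sub>v (J * M) \<longleftrightarrow> (\<forall>l<J. fourier_coeff M x l i = 0)" if i: "i < M" for i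
  proof
    assume row: "row (sys_C' M J x) i = 0\<^sub>v (J * M)"
    show "\<forall>l<J. fourier_coeff M x l i = 0"
    proof (intro allI impI)
      \<comment> \<open>Row \<open>i\<close> meets the diagonal of block \<open>l\<close> in column
        \<open>l * M + i\<close>, so this entry isolates the coefficient.\<close>
      fix l assume l: "l < J"
      then have c: "l * M + i < J * M"
        using i by (simp add: block_index_less)
      have "sys_C' M J x $$ (i, l * M + i) = 0"
        using arg_cong[OF row, of "\<lambda>v. v $ (l * M + i)"] i c sys_C'_carrier[of M J x] by simp
      then show "fourier_coeff M x l i = 0"
        using i c by (simp add: sys_C'_index)
    qed
  next
    assume zero: "\<forall>l<J. fourier_coeff M x l i = 0"
    show "row (sys_C' M J x) i = 0\<^sub>v (J * M)"
      using i zero sys_C'_carrier[of M J x]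
      by (intro eq_vecI) (auto simp: sys_C'_index less_mult_imp_div_less)
  qed
  then show ?thesis
    using sys_C'_carrier[of M J x] by (auto simp: nonzero_rows_def)
qed

lemma nth_nonzero_rows_sys_C':
  assumes "p < length (nonzero_rows (sys_C' M J x))"
  shows "nonzero_rows (sys_C' M J x) ! p < M"
    and "\<exists>l<J. fourier_coeff M x l (nonzero_rows (sys_C' M J x) ! p) \<noteq> 0"
  using nth_mem[OF assms] by (auto simp: nonzero_rows_sys_C')

lemma sys_C_index:
  assumes "p < length (nonzero_rows (sys_C' M J x))" "c < J * M"
  shows "sys_C M J x $$ (p, c) = sys_C' M J x $$ (nonzero_rows (sys_C' M J x) ! p, c)"
  unfolding sys_C_def using assms sys_C'_carrier[of M J x] by (intro row_elim_mult_index) auto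

text \<open>In the Markov parameter \<open>C A^t B\<close> each input \<open>l\<close> sees only
  diagonal factors: \<open>Lambda_inv\<close> contributes the power, \<open>e_col\<close> sums over
  one surviving entry, and row elimination relabels row \<open>p\<close> as its frequency.\<close>

lemma sys_markov_index:
  assumes p: "p < length (nonzero_rows (sys_C' M J x))" and l: "l < J"
  shows "(sys_C M J x * (sys_A M J ^\<^sub>m t) * sys_B M J) $$ (p, l) =
    fourier_coeff M x l (nonzero_rows (sys_C' M J x) ! p) *
    inverse (omega M ^ (nonzero_rows (sys_C' M J x) ! p)) ^ t"
proof -
  let ?C' = "sys_C' M J x" and ?A = "sys_A M J ^\<^sub>m t" and ?B = "sys_B M J"
  define i where "i = nonzero_rows ?C' ! p"
  have i: "i < M"
    unfolding i_def using p by (rule nth_nonzero_rows_sys_C')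
  have A: "?A = block_diag J (mat_diag M (\<lambda>i. inverse (omega M ^ i) ^ t))"
    unfolding sys_A_def by (subst block_diag_pow[OF Lambda_inv_carrier]) (simp add: Lambda_inv_def mat_diag_pow)
  have A_carrier: "?A \<in> carrier_mat (J * M) (J * M)"
    using sys_A_carrier by (rule pow_carrier_mat)
  have E: "row_elim ?C' \<in> carrier_mat (length (nonzero_rows ?C')) M"
    using sys_C'_carrier[of M J x] by (intro carrier_matI) auto
  have "sys_C M J x * ?A * ?B = row_elim ?C' * (?C' * ?A * ?B)"
    unfolding sys_C_def using E sys_C'_carrier[of M J x] A_carrier sys_B_carrier[of M J]
    by (simp add: assoc_mult_mat[of _ _ M _ "J * M"] assoc_mult_mat[of _ _ M _ J])
  then have "(sys_C M J x * ?A * ?B) $$ (p, l) = (?C' * ?A * ?B) $$ (i, l)"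
    unfolding i_def using p l sys_C'_carrier[of M J x] sys_B_carrier[of M J]
    by (simp only:) (intro row_elim_mult_index[of _ _ J], auto)
  also have "?C' * ?A * ?B =
      hconcat M 1 J (\<lambda>l. mat_diag M (fourier_coeff M x l) * mat_diag M (\<lambda>i. inverse (omega M ^ i) ^ t) * e_col M)"
    unfolding A sys_C'_def sys_B_def
    by (subst hconcat_mult_block_diag[of _ _ _ M _ M], simp, simp,
        subst hconcat_mult_block_diag[of _ _ _ M _ 1]) (auto simp del: One_nat_def)
  also have "\<dots> $$ (i, l) = fourier_coeff M x l i * inverse (omega M ^ i) ^ t"
    using i l by (simp add: hconcat_index mat_diag_mult_left[OF e_col_carrier] e_col_index)
  finally show ?thesis
    unfolding i_def .
qed

section \<open>Ranks of the output controllability and output matrices\<close>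

lemma oc_mat_carrier:
  "oc_mat (sys_A M J) (sys_B M J) (sys_C M J x) n \<in>
    carrier_mat (length (nonzero_rows (sys_C' M J x))) (n * J)"
  using sys_C_carrier[of M J x] sys_B_carrier[of M J]
  by (intro carrier_matI) (auto simp: oc_mat_def)

lemma oc_mat_index:
  assumes "p < length (nonzero_rows (sys_C' M J x))" "c < n * J"
  shows "oc_mat (sys_A M J) (sys_B M J) (sys_C M J x) n $$ (p, c) =
    fourier_coeff M x (c mod J) (nonzero_rows (sys_C' M J x) ! p) *
    inverse (omega M ^ (nonzero_rows (sys_C' M J x) ! p)) ^ (c div J)"
  using assms sys_C_carrier[of M J x] sys_B_carrier[of M J]
  by (simp add: oc_mat_def hconcat_index mult.commute sys_markov_index mod_less_of_less_mult
      del: index_mult_mat)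

lemma oc_mat_mult_vec:
  assumes "k \<in> carrier_vec (n * J)" "p < length (nonzero_rows (sys_C' M J x))"
  shows "(oc_mat (sys_A M J) (sys_B M J) (sys_C M J x) n *\<^sub>v k) $ p =
    (\<Sum>c<n * J. fourier_coeff M x (c mod J) (nonzero_rows (sys_C' M J x) ! p) *
      inverse (omega M ^ (nonzero_rows (sys_C' M J x) ! p)) ^ (c div J) * k $ c)"
  using assms oc_mat_carrier[of M J x n]
  by (auto simp: scalar_prod_def lessThan_atLeast0 oc_mat_index intro!: sum.cong)

text \<open>Each unit vector gets an explicit preimage. The case \<open>n = M\<close> bounds the
  index; \<open>n = J * M\<close>, the state dimension, gives output controllability.\<close>

lemma oc_mat_full_rank:
  assumes "M \<le> n"
  shows "mat_rank (oc_mat (sys_A M J) (sys_B M J) (sys_C M J x) n) = length (nonzero_rows (sys_C' M J x))"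
proof -
  let ?\<gamma> = "nonzero_rows (sys_C' M J x)" and ?X = "oc_mat (sys_A M J) (sys_B M J) (sys_C M J x) n"
  have "\<exists>k \<in> carrier_vec (n * J). ?X *\<^sub>v k = unit_vec (length ?\<gamma>) p" if p: "p < length ?\<gamma>" for p
  proof -
    obtain l where l: "l < J" "fourier_coeff M x l (?\<gamma> ! p) \<noteq> 0"
      using nth_nonzero_rows_sys_C'(2)[OF p] by blast
    \<comment> \<open>Only input \<open>l\<close>, which excites frequency
      \<open>?\<gamma> ! p\<close>, is used. The weights over the first \<open>M\<close> blocks are
      the character dual to row \<open>p\<close>, scaled to give 1 there; orthogonality kills all
      other rows, and later blocks get weight 0.\<close>
    define g where "g t j = (if j = l \<and> t < M
      then (omega M ^ (?\<gamma> ! p)) ^ t / (of_nat M * fourier_coeff M x l (?\<gamma> ! p)) else 0)" for t j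
    define k where "k = vec (n * J) (\<lambda>c. g (c div J) (c mod J))"
    have k: "k \<in> carrier_vec (n * J)" by (simp add: k_def)
    have "?X *\<^sub>v k = unit_vec (length ?\<gamma>) p"
    proof (rule eq_vecI)
      fix q assume "q < dim_vec (unit_vec (length ?\<gamma>) p :: complex vec)"
      then have q: "q < length ?\<gamma>" by simp
      let ?a = "\<lambda>j. fourier_coeff M x j (?\<gamma> ! q)" and ?z = "inverse (omega M ^ (?\<gamma> ! q))"
      have "(?X *\<^sub>v k) $ q = (\<Sum>c<n * J. ?a (c mod J) * ?z ^ (c div J) * g (c div J) (c mod J))"
        unfolding oc_mat_mult_vec[OF k q] by (intro sum.cong) (auto simp: k_def)
      also have "\<dots> = (\<Sum>t<n. \<Sum>j<J. ?a j * ?z ^ t * g t j)"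
        by (rule sum_div_mod)
      also have "\<dots> = (\<Sum>t<n. ?a l * ?z ^ t * g t l)"
      proof (rule sum.cong[OF refl])
        fix t
        have "(\<Sum>j<J. ?a j * ?z ^ t * g t j) = (\<Sum>j<J. if j = l then ?a l * ?z ^ t * g t l else 0)"
          by (rule sum.cong) (auto simp: g_def)
        then show "(\<Sum>j<J. ?a j * ?z ^ t * g t j) = ?a l * ?z ^ t * g t l"
          using l(1) by simp
      qed
      also have "\<dots> = (\<Sum>t<M. ?a l * ?z ^ t * g t l)"
        using assms by (intro sum.mono_neutral_right) (auto simp: g_def)
      also have "\<dots> = ?a l / (of_nat M * fourier_coeff M x l (?\<gamma> ! p)) *
          (\<Sum>t<M. ?z ^ t * (omega M ^ (?\<gamma> ! p)) ^ t)"
        by (simp add: g_def sum_distrib_left mult.assoc)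
      also have "\<dots> = (if q = p then 1 else 0)"
        using roots_of_unity_orthogonal[OF nth_nonzero_rows_sys_C'(1)[OF q] nth_nonzero_rows_sys_C'(1)[OF p]]
          l(2) nth_eq_iff_index_eq[OF distinct_nonzero_rows q p] nth_nonzero_rows_sys_C'(1)[OF p]
        by auto
      finally show "(?X *\<^sub>v k) $ q = unit_vec (length ?\<gamma>) p $ q"
        using p q by auto
    qed (use oc_mat_carrier[of M J x n] in auto)
    then show ?thesis using k by blast
  qed
  then have "mat_rank ?X = card {..<length ?\<gamma>}"
    by (intro rank_eq_card[OF oc_mat_carrier]) auto
  then show ?thesis by simp
qed

lemma mat_rank_sys_C: "mat_rank (sys_C M J x) = length (nonzero_rows (sys_C' M J x))"
proof -
  let ?\<gamma> = "nonzero_rows (sys_C' M J x)"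
  have "\<exists>k \<in> carrier_vec (J * M). sys_C M J x *\<^sub>v k = unit_vec (length ?\<gamma>) p" if p: "p < length ?\<gamma>" for p
  proof -
    note i = nth_nonzero_rows_sys_C'(1)[OF p]
    obtain l where l: "l < J" "fourier_coeff M x l (?\<gamma> ! p) \<noteq> 0"
      using nth_nonzero_rows_sys_C'(2)[OF p] by blast
    \<comment> \<open>This column of the output matrix has a single non-zero entry, in row
      \<open>p\<close>, so rescaling it gives the unit vector.\<close>
    define c where "c = l * M + ?\<gamma> ! p"
    have c: "c < J * M" "c mod M = ?\<gamma> ! p" "c div M = l"
      using i l by (auto simp: c_def block_index_less)
    let ?k = "(1 / fourier_coeff M x l (?\<gamma> ! p)) \<cdot>\<^sub>v unit_vec (J * M) c"
    have "sys_C M J x *\<^sub>v ?k = unit_vec (length ?\<gamma>) p"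
    proof (rule eq_vecI)
      fix q assume "q < dim_vec (unit_vec (length ?\<gamma>) p :: complex vec)"
      then have q: "q < length ?\<gamma>" by simp
      then show "(sys_C M J x *\<^sub>v ?k) $ q = unit_vec (length ?\<gamma>) p $ q"
        using p c l nth_eq_iff_index_eq[OF distinct_nonzero_rows p q] nth_nonzero_rows_sys_C'(1)[OF q]
          sys_C_carrier[of M J x]
        by (auto simp: scalar_prod_right_unit sys_C_index sys_C'_index)
    qed (use sys_C_carrier[of M J x] in auto)
    then show ?thesis
      by (intro bexI[of _ ?k]) auto
  qed
  then have "mat_rank (sys_C M J x) = card {..<length ?\<gamma>}"
    by (intro rank_eq_card[OF sys_C_carrier]) auto
  then show ?thesis by simp
qed

lemma mat_rank_sys_C': "mat_rank (sys_C' M J x) = length (nonzero_rows (sys_C' M J x))"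
proof -
  let ?S = "set (nonzero_rows (sys_C' M J x))"
  \<comment> \<open>Here zero rows are still present, so the image is only the span of the unit
    vectors of the active frequencies.\<close>
  have "mat_rank (sys_C' M J x) = card ?S"
  proof (rule rank_eq_card[OF sys_C'_carrier])
    show "?S \<subseteq> {..<M}"
      by (auto simp: nonzero_rows_sys_C')
    show "sys_C' M J x $$ (i, c) = 0" if "i < M" "i \<notin> ?S" "c < J * M" for i c
      using that by (auto simp: nonzero_rows_sys_C' sys_C'_index less_mult_imp_div_less)
    fix i assume "i \<in> ?S"
    then obtain l where i: "i < M" and l: "l < J" "fourier_coeff M x l i \<noteq> 0"
      by (auto simp: nonzero_rows_sys_C')
    define c where "c = l * M + i"
    have c: "c < J * M" "c mod M = i" "c div M = l"
      using i l by (auto simp: c_def block_index_less)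
    let ?k = "(1 / fourier_coeff M x l i) \<cdot>\<^sub>v unit_vec (J * M) c"
    have "sys_C' M J x *\<^sub>v ?k = unit_vec M i"
      using i c l sys_C'_carrier[of M J x]
      by (intro eq_vecI) (auto simp: scalar_prod_right_unit sys_C'_index)
    then show "\<exists>k \<in> carrier_vec (J * M). sys_C' M J x *\<^sub>v k = unit_vec M i"
      by (intro bexI[of _ ?k]) auto
  qed
  then show ?thesis
    by (simp add: distinct_card[OF distinct_nonzero_rows])
qed


section \<open>Solvability with time delays\<close>

lemma length_nonzero_rows_pos:
  assumes "nonzero_signal M J x"
  shows "0 < length (nonzero_rows (sys_C' M J x))"
proof -
  obtain l k where lk: "l < J" "k < M" "x l k \<noteq> 0"
    using assms by (auto simp: nonzero_signal_def)
  have "\<exists>i<M. fourier_coeff M x l i \<noteq> 0"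
  proof (rule ccontr)
    assume "\<not> ?thesis"
    then have "of_real (x l k) = (0::complex)"
      using inverse_dft[OF lk(2), of "\<lambda>k. of_real (x l k)"] by (simp add: fourier_coeff_eq_dft)
    then show False using lk by simp
  qed
  then have "set (nonzero_rows (sys_C' M J x)) \<noteq> {}"
    using lk(1) by (auto simp: nonzero_rows_sys_C')
  then show ?thesis by auto
qed

lemma sys_index_eq:
  "sys_index M J x = (LEAST n. mat_rank (oc_mat (sys_A M J) (sys_B M J) (sys_C M J x) n) =
    length (nonzero_rows (sys_C' M J x)))"
  using sys_C_carrier[of M J x] by (simp add: sys_index_def oc_index_def)

lemma oc_mat_full_rank_sys_index:
  "mat_rank (oc_mat (sys_A M J) (sys_B M J) (sys_C M J x) (sys_index M J x)) =
    length (nonzero_rows (sys_C' M J x))"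
  unfolding sys_index_eq by (rule LeastI) (rule oc_mat_full_rank[OF le_refl])

lemma sys_index_le: "sys_index M J x \<le> M"
  unfolding sys_index_eq by (rule Least_le) (rule oc_mat_full_rank[OF le_refl])

text \<open>With 0 blocks the matrix has no columns and its image is 0, yet there is at least one
  output. This guarantees that \<open>sys_index M J x - 1\<close> is not truncated.\<close>

lemma sys_index_pos:
  assumes "nonzero_signal M J x"
  shows "1 \<le> sys_index M J x"
proof (rule ccontr)
  let ?P = "length (nonzero_rows (sys_C' M J x))" and ?X = "oc_mat (sys_A M J) (sys_B M J) (sys_C M J x) 0"
  assume "\<not> ?thesis"
  then have "sys_index M J x = 0"
    by simp
  then have "mat_rank ?X = ?P"
    using oc_mat_full_rank_sys_index[of M J x] by (simp only:)
  from full_row_rank_imp_solvable[OF oc_mat_carrier this, of "unit_vec ?P 0"]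
  obtain k where k: "k \<in> carrier_vec (0 * J)" "?X *\<^sub>v k = unit_vec ?P 0"
    by auto
  have P: "0 < ?P"
    using assms by (rule length_nonzero_rows_pos)
  have "(?X *\<^sub>v k) $ 0 = 0"
    using oc_mat_mult_vec[OF k(1) P] by simp
  then show False
    using k(2) P by simp
qed

section \<open>The spectral equation in coordinates\<close>

text \<open>The matrix equation at row \<open>i\<close> and column \<open>m\<close>, where
  \<open>K l d m\<close> is the weight of delay \<open>d\<close> of component \<open>l\<close> in
  the prediction of component \<open>m\<close>. A function in place of a matrix keeps dimension
  bookkeeping out of the Fourier argument.\<close>

definition spectral_eq where
  "spectral_eq M J x L K \<longleftrightarrow> (\<forall>i<M. \<forall>m<J. omega M ^ i * fourier_coeff M x m i =
    (\<Sum>l<J. \<Sum>d\<le>L. fourier_coeff M x l i * inverse (omega M ^ i) ^ d * K l d m))"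

lemma spectral_solvable_iff: "spectral_solvable M J x L \<longleftrightarrow> (\<exists>K. spectral_eq M J x L K)"
proof -
  let ?C' = "sys_C' M J x" and ?BB = "block_diag J (b_col M)" and ?AA = "block_diag J (A_delay M L)"
  have BB: "?BB \<in> carrier_mat (J * M) J" and AA: "?AA \<in> carrier_mat (J * M) (J * (L + 1))"
    using block_diag_carrier[OF b_col_carrier] block_diag_carrier[OF A_delay_carrier] by auto
  have eq: "?C' * (?BB - ?AA * K) = 0\<^sub>m M J \<longleftrightarrow> spectral_eq M J x L (\<lambda>l d m. K $$ (l * (L + 1) + d, m))"
    if K: "K \<in> carrier_mat (J * (L + 1)) J" for K
  proof -
    have B_index: "(?C' * ?BB) $$ (i, m) = omega M ^ i * fourier_coeff M x m i" if "i < M" "m < J" for i m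
      using sys_C'_mult_block_diag_index[OF b_col_carrier that(1), of m J x] that by (simp add: b_col_def)
    have A_index: "(?C' * ?AA * K) $$ (i, m) =
        (\<Sum>l<J. \<Sum>d\<le>L. fourier_coeff M x l i * inverse (omega M ^ i) ^ d * K $$ (l * (L + 1) + d, m))"
      if i: "i < M" and m: "m < J" for i m
    proof -
      have entry: "(?C' * ?AA) $$ (i, c) =
          fourier_coeff M x (c div (L + 1)) i * inverse (omega M ^ i) ^ (c mod (L + 1))"
        if c: "c < J * (L + 1)" for c
        using sys_C'_mult_block_diag_index[OF A_delay_carrier i c, of x] A_delay_index[OF i, of "c mod (L + 1)" L]
        by (simp del: index_mult_mat)
      have mult_index: "(Y * K) $$ (i, m) = (\<Sum>c<J * (L + 1). Y $$ (i, c) * K $$ (c, m))"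
        if "Y \<in> carrier_mat M (J * (L + 1))" for Y
        using that K i m by (simp add: scalar_prod_def lessThan_atLeast0)
      have "(?C' * ?AA * K) $$ (i, m) = (\<Sum>c<J * (L + 1). (?C' * ?AA) $$ (i, c) * K $$ (c, m))"
        by (rule mult_index[OF mult_carrier_mat[OF sys_C'_carrier AA]])
      \<comment> \<open>The row index of \<open>K\<close> is written out as quotient and remainder
        to match the shape of \<open>sum_div_mod\<close>.\<close>
      also have "\<dots> = (\<Sum>c<J * (L + 1). fourier_coeff M x (c div (L + 1)) i *
          inverse (omega M ^ i) ^ (c mod (L + 1)) * K $$ (c div (L + 1) * (L + 1) + c mod (L + 1), m))"
        by (rule sum.cong[OF refl]) (simp only: entry lessThan_iff div_mult_mod_eq)
      also have "\<dots> = (\<Sum>l<J. \<Sum>d<L + 1. fourier_coeff M x l i * inverse (omega M ^ i) ^ d * K $$ (l * (L + 1) + d, m))"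
        by (rule sum_div_mod)
      finally show ?thesis
        by (simp add: lessThan_Suc_atMost)
    qed
    have "?C' * (?BB - ?AA * K) = ?C' * ?BB - ?C' * ?AA * K"
      by (simp only: mult_minus_distrib_mat[OF sys_C'_carrier BB mult_carrier_mat[OF AA K]]
          assoc_mult_mat[OF sys_C'_carrier AA K])
    then show ?thesis
      unfolding spectral_eq_def
      by (simp only: minus_mat_eq_zero_iff[OF mult_carrier_mat[OF sys_C'_carrier BB]
          mult_carrier_mat[OF mult_carrier_mat[OF sys_C'_carrier AA] K]] A_index B_index cong: imp_cong)
  qed
  show ?thesis
  proof
    assume "spectral_solvable M J x L"
    then obtain K where K: "K \<in> carrier_mat (J * (L + 1)) J" and "?C' * (?BB - ?AA * K) = 0\<^sub>m M J"
      unfolding spectral_solvable_def by blast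
    then show "\<exists>K. spectral_eq M J x L K"
      unfolding eq[OF K] by blast
  next
    assume "\<exists>K. spectral_eq M J x L K"
    then obtain K where K: "spectral_eq M J x L K" ..
    obtain K' where K'_carrier: "K' \<in> carrier_mat (J * (L + 1)) J"
      and "\<forall>l<J. \<forall>d<L + 1. \<forall>m<J. K' $$ (l * (L + 1) + d, m) = K l d m"
      using ex_mat_of_blocks[of J "L + 1" J K] by blast
    then have "spectral_eq M J x L (\<lambda>l d m. K' $$ (l * (L + 1) + d, m))"
      using K by (simp add: spectral_eq_def)
    then show "spectral_solvable M J x L"
      unfolding spectral_solvable_def by (intro bexI[OF _ K'_carrier]) (simp only: eq[OF K'_carrier])
  qed
qed

text \<open>With \<mu> blocks the exponents are 0 to \<mu> - 1, which are exactly the delays for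
  \<open>L\<close> = \<mu> - 1. Full row rank solves the equation separately for every component
  \<open>m\<close>.\<close>

lemma spectral_solvable_sys_index:
  assumes "nonzero_signal M J x"
  shows "spectral_solvable M J x (sys_index M J x - 1)"
proof -
  let ?\<gamma> = "nonzero_rows (sys_C' M J x)"
  define n where "n = sys_index M J x"
  have n: "{..<n} = {..n - 1}"
    using sys_index_pos[OF assms] by (auto simp: n_def)
  let ?X = "oc_mat (sys_A M J) (sys_B M J) (sys_C M J x) n"
  let ?v = "\<lambda>m. vec (length ?\<gamma>) (\<lambda>p. omega M ^ (?\<gamma> ! p) * fourier_coeff M x m (?\<gamma> ! p))"
  have rank: "mat_rank ?X = length ?\<gamma>"
    unfolding n_def by (rule oc_mat_full_rank_sys_index)
  have "\<forall>m. \<exists>k. k \<in> carrier_vec (n * J) \<and> ?X *\<^sub>v k = ?v m"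
    using full_row_rank_imp_solvable[OF oc_mat_carrier rank vec_carrier] by blast
  from choice[OF this] obtain k where k: "\<And>m. k m \<in> carrier_vec (n * J)"
    and eq: "\<And>m. ?X *\<^sub>v k m = ?v m"
    by blast
  \<comment> \<open>The controllability matrix orders its columns by delay first and component
    second, hence the position \<open>d * J + l\<close>.\<close>
  have solution: "omega M ^ i * fourier_coeff M x m i =
      (\<Sum>l<J. \<Sum>d<n. fourier_coeff M x l i * inverse (omega M ^ i) ^ d * k m $ (d * J + l))"
    if i: "i < M" and m: "m < J" for i m
  proof (cases "i \<in> set ?\<gamma>")
    case True
    then obtain p where p: "p < length ?\<gamma>" "?\<gamma> ! p = i"
      by (auto simp: in_set_conv_nth)
    have "omega M ^ i * fourier_coeff M x m i = (?X *\<^sub>v k m) $ p"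
      using p by (simp add: eq)
    also have "\<dots> = (\<Sum>c<n * J. fourier_coeff M x (c mod J) i * inverse (omega M ^ i) ^ (c div J) *
        k m $ (c div J * J + c mod J))"
      unfolding oc_mat_mult_vec[OF k p(1)] p(2) div_mult_mod_eq ..
    also have "\<dots> = (\<Sum>d<n. \<Sum>l<J. fourier_coeff M x l i * inverse (omega M ^ i) ^ d * k m $ (d * J + l))"
      by (rule sum_div_mod)
    finally show ?thesis
      by (subst sum.swap)
  next
    \<comment> \<open>At an eliminated frequency all coefficients vanish, so both sides are
      0.\<close>
    case False
    then show ?thesis
      using i m by (simp add: nonzero_rows_sys_C')
  qed
  have "spectral_eq M J x (n - 1) (\<lambda>l d m. k m $ (d * J + l))"
    unfolding spectral_eq_def n[symmetric] using solution by blast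
  then show ?thesis
    unfolding spectral_solvable_iff n_def by blast
qed

section \<open>Reconstruction in the time domain\<close>

lemma perfect_reconstruction_iff:
  "perfect_reconstruction M J x L \<longleftrightarrow> (\<exists>K. \<forall>k<M. \<forall>m<J. x m ((k + 1) mod M) =
    (\<Sum>l<J. \<Sum>d\<le>L. K l d m * x l (nat ((int k - int d) mod int M))))"
proof -
  define y where "y k l d = x l (nat ((int k - int d) mod int M))" for k l d
  have eq: "sample_vec J x ((k + 1) mod M) = transpose_mat K *\<^sub>v stacked_delay_vec M J L x k \<longleftrightarrow>
      (\<forall>m<J. x m ((k + 1) mod M) = (\<Sum>l<J. \<Sum>d\<le>L. K $$ (l * (L + 1) + d, m) * y k l d))"
    if K: "K \<in> carrier_mat (J * (L + 1)) J" for K k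
  proof -
    have "(transpose_mat K *\<^sub>v stacked_delay_vec M J L x k) $ m =
        (\<Sum>l<J. \<Sum>d\<le>L. K $$ (l * (L + 1) + d, m) * y k l d)" if m: "m < J" for m
    proof -
      have "(transpose_mat K *\<^sub>v stacked_delay_vec M J L x k) $ m =
          (\<Sum>c<J * (L + 1). K $$ (c div (L + 1) * (L + 1) + c mod (L + 1), m) * y k (c div (L + 1)) (c mod (L + 1)))"
        unfolding div_mult_mod_eq using K m
        by (auto simp: scalar_prod_def stacked_delay_vec_def delay_vec_def y_def lessThan_atLeast0 intro!: sum.cong)
      also have "\<dots> = (\<Sum>l<J. \<Sum>d<L + 1. K $$ (l * (L + 1) + d, m) * y k l d)"
        by (rule sum_div_mod)
      finally show ?thesis
        by (simp add: lessThan_Suc_atMost)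
    qed
    then show ?thesis
      using K by (auto simp: sample_vec_def vec_eq_iff)
  qed
  show ?thesis
    unfolding y_def[symmetric]
  proof
    assume "perfect_reconstruction M J x L"
    then obtain K where K: "K \<in> carrier_mat (J * (L + 1)) J"
      and "\<forall>k<M. sample_vec J x ((k + 1) mod M) = transpose_mat K *\<^sub>v stacked_delay_vec M J L x k"
      unfolding perfect_reconstruction_def by blast
    then have "\<forall>k<M. \<forall>m<J. x m ((k + 1) mod M) = (\<Sum>l<J. \<Sum>d\<le>L. K $$ (l * (L + 1) + d, m) * y k l d)"
      by (simp only: eq[OF K])
    then show "\<exists>K. \<forall>k<M. \<forall>m<J. x m ((k + 1) mod M) = (\<Sum>l<J. \<Sum>d\<le>L. K l d m * y k l d)"
      by (intro exI[of _ "\<lambda>l d m. K $$ (l * (L + 1) + d, m)"])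
  next
    assume "\<exists>K. \<forall>k<M. \<forall>m<J. x m ((k + 1) mod M) = (\<Sum>l<J. \<Sum>d\<le>L. K l d m * y k l d)"
    then obtain K where K: "\<forall>k<M. \<forall>m<J. x m ((k + 1) mod M) = (\<Sum>l<J. \<Sum>d\<le>L. K l d m * y k l d)" ..
    obtain K' where K'_carrier: "K' \<in> carrier_mat (J * (L + 1)) J"
      and "\<forall>l<J. \<forall>d<L + 1. \<forall>m<J. K' $$ (l * (L + 1) + d, m) = K l d m"
      using ex_mat_of_blocks[of J "L + 1" J K] by blast
    then have "\<forall>k<M. \<forall>m<J. x m ((k + 1) mod M) = (\<Sum>l<J. \<Sum>d\<le>L. K' $$ (l * (L + 1) + d, m) * y k l d)"
      using K by simp
    then show "perfect_reconstruction M J x L"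
      unfolding perfect_reconstruction_def by (intro bexI[OF _ K'_carrier]) (simp only: eq[OF K'_carrier])
  qed
qed

text \<open>For each component \<open>m\<close> the two sides of the spectral equation are the
  transforms of the successor sequence and of the weighted sum of delayed sequences; injectivity of
  the transform finishes.\<close>

lemma spectral_eq_iff_time_domain:
  assumes "M > 0"
  shows "spectral_eq M J x L K \<longleftrightarrow> (\<forall>k<M. \<forall>m<J. of_real (x m ((k + 1) mod M)) =
    (\<Sum>l<J. \<Sum>d\<le>L. K l d m * of_real (x l (nat ((int k - int d) mod int M)))))"
proof -
  have "(\<forall>i<M. omega M ^ i * fourier_coeff M x m i =
      (\<Sum>l<J. \<Sum>d\<le>L. fourier_coeff M x l i * inverse (omega M ^ i) ^ d * K l d m)) \<longleftrightarrow>
    (\<forall>k<M. of_real (x m ((k + 1) mod M)) =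
      (\<Sum>l<J. \<Sum>d\<le>L. K l d m * of_real (x l (nat ((int k - int d) mod int M)))))" for m
  proof -
    let ?y = "\<lambda>k. complex_of_real (x m ((k + 1) mod M))"
    let ?z = "\<lambda>k. \<Sum>l<J. \<Sum>d\<le>L. K l d m * complex_of_real (x l (nat ((int k - int d) mod int M)))"
    have "dft M ?y i = omega M ^ i * fourier_coeff M x m i" for i
      using dft_successor[OF assms, of "\<lambda>k. complex_of_real (x m k)"] by (simp add: fourier_coeff_eq_dft)
    moreover have "dft M ?z i =
        (\<Sum>l<J. \<Sum>d\<le>L. fourier_coeff M x l i * inverse (omega M ^ i) ^ d * K l d m)" for i
    proof -
      have "dft M ?z i = (\<Sum>l<J. dft M (\<lambda>k. \<Sum>d\<le>L. K l d m * complex_of_real (x l (nat ((int k - int d) mod int M)))) i)"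
        using dft_sum[of M "\<lambda>_. 1"] by simp
      also have "\<dots> = (\<Sum>l<J. \<Sum>d\<le>L. K l d m * (inverse (omega M ^ i) ^ d * fourier_coeff M x l i))"
        by (simp add: dft_sum dft_delay[OF assms, of "\<lambda>k. complex_of_real (x _ k)"] fourier_coeff_eq_dft)
      finally show ?thesis
        by (simp add: mult_ac)
    qed
    ultimately show ?thesis
      using dft_eq_iff[of M ?y ?z] by simp
  qed
  then show ?thesis
    unfolding spectral_eq_def by blast
qed

text \<open>The samples are real, so taking real parts turns complex gains into real ones;
  conversely real gains are complex.\<close>

lemma spectral_solvable_iff_perfect_reconstruction:
  assumes "M > 0"
  shows "spectral_solvable M J x L \<longleftrightarrow> perfect_reconstruction M J x L"
proof
  assume "spectral_solvable M J x L"
  then obtain K where K: "\<forall>k<M. \<forall>m<J. complex_of_real (x m ((k + 1) mod M)) =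
      (\<Sum>l<J. \<Sum>d\<le>L. K l d m * of_real (x l (nat ((int k - int d) mod int M))))"
    by (auto simp: spectral_solvable_iff spectral_eq_iff_time_domain[OF assms])
  have "x m ((k + 1) mod M) = (\<Sum>l<J. \<Sum>d\<le>L. Re (K l d m) * x l (nat ((int k - int d) mod int M)))"
    if "k < M" "m < J" for k m
    using arg_cong[OF K[rule_format, OF that], of Re] by (simp add: Re_sum)
  then show "perfect_reconstruction M J x L"
    unfolding perfect_reconstruction_iff by (intro exI[of _ "\<lambda>l d m. Re (K l d m)"]) blast
next
  assume "perfect_reconstruction M J x L"
  then obtain K where K: "\<And>k m. k < M \<Longrightarrow> m < J \<Longrightarrow> x m ((k + 1) mod M) =
      (\<Sum>l<J. \<Sum>d\<le>L. K l d m * x l (nat ((int k - int d) mod int M)))"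
    unfolding perfect_reconstruction_iff by blast
  then have "spectral_eq M J x L (\<lambda>l d m. of_real (K l d m))"
    by (simp add: spectral_eq_iff_time_domain[OF assms])
  then show "spectral_solvable M J x L"
    unfolding spectral_solvable_iff by blast
qed

section \<open>A signal attaining the bound\<close>

definition impulse :: "nat \<Rightarrow> nat \<Rightarrow> real" where
  "impulse l k = (if l = 0 \<and> k = 0 then 1 else 0)"

text \<open>The successor of sample \<open>M - 1\<close> is the impulse itself, but delays
  \<open>d \<le> L < M - 1\<close> from there only reach the samples \<open>M - 1 - d > 0\<close>,
  which are all 0: a linear predictor would return 0 in place of 1.\<close>

lemma perfect_reconstruction_impulse:
  assumes "M > 0" "J > 0" "perfect_reconstruction M J impulse L"
  shows "M - 1 \<le> L"
proof (rule ccontr)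
  assume L: "\<not> ?thesis"
  have zero: "impulse l (nat ((int (M - 1) - int d) mod int M)) = 0" if "d \<le> L" for l d
  proof -
    have "int (M - 1) - int d = int (M - 1 - d)"
      using that L by linarith
    moreover have "int (M - 1 - d) mod int M = int (M - 1 - d)"
      using assms(1) by (intro mod_pos_pos_trivial) auto
    ultimately have "(int (M - 1) - int d) mod int M = int (M - 1 - d)"
      by (simp only:)
    moreover have "M - 1 - d \<noteq> 0"
      using that L by linarith
    ultimately show ?thesis
      by (simp only: nat_int impulse_def) simp
  qed
  obtain K where "\<forall>k<M. \<forall>m<J. impulse m ((k + 1) mod M) =
      (\<Sum>l<J. \<Sum>d\<le>L. K l d m * impulse l (nat ((int k - int d) mod int M)))"
    using assms(3) unfolding perfect_reconstruction_iff by blast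
  from this[rule_format, of "M - 1" 0]
  have "impulse 0 ((M - 1 + 1) mod M) =
      (\<Sum>l<J. \<Sum>d\<le>L. K l d 0 * impulse l (nat ((int (M - 1) - int d) mod int M)))"
    using assms(1,2) by linarith
  also have "\<dots> = 0"
    by (intro sum.neutral ballI) (simp only: zero atMost_iff mult_zero_right)
  finally show False
    using assms(1) by (simp add: impulse_def)
qed

text \<open>Feasibility and \<open>sys_index M J x \<ge> 1\<close> appear as conjuncts because
  \<open>LEAST\<close> has its meaning only when a witness exists and subtraction on naturals
  truncates. Tightness is witnessed for every \<open>M\<close> and \<open>J\<close> by the
  impulse.\<close>

theorem theorem2:
  fixes M J :: nat
  assumes "M \<ge> 1" and "J \<ge> 1"
  shows
    "(\<forall>x. nonzero_signal M J x \<longrightarrow>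
        mat_rank (sys_C M J x) = length (nonzero_rows (sys_C' M J x)) \<and>
        mat_rank (sys_C' M J x) = length (nonzero_rows (sys_C' M J x)) \<and>
        output_controllable (sys_A M J) (sys_B M J) (sys_C M J x) \<and>
        sys_index M J x \<ge> 1 \<and>
        (\<exists>L. spectral_solvable M J x L) \<and>
        min_delays (spectral_solvable M J x) \<le> sys_index M J x - 1 \<and>
        (\<exists>L. perfect_reconstruction M J x L) \<and>
        min_delays (perfect_reconstruction M J x) \<le> sys_index M J x - 1)
     \<and>
     (\<exists>x. nonzero_signal M J x \<and>
        min_delays (spectral_solvable M J x) = sys_index M J x - 1 \<and>
        min_delays (perfect_reconstruction M J x) = sys_index M J x - 1)"
proof -
  have pos: "M > 0" "J > 0"
    using assms by auto
  have equiv: "spectral_solvable M J x = perfect_reconstruction M J x" for x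
    using spectral_solvable_iff_perfect_reconstruction[OF pos(1)] by blast
  have feasible: "perfect_reconstruction M J x (sys_index M J x - 1)" if "nonzero_signal M J x" for x
    using spectral_solvable_sys_index[OF that] by (simp add: equiv)
  then have upper: "min_delays (perfect_reconstruction M J x) \<le> sys_index M J x - 1"
    if "nonzero_signal M J x" for x
    unfolding min_delays_def using that by (intro Least_le) blast
  have impulse: "nonzero_signal M J impulse"
    using pos by (auto simp: nonzero_signal_def impulse_def)
  have "perfect_reconstruction M J impulse (min_delays (perfect_reconstruction M J impulse))"
    unfolding min_delays_def by (rule LeastI[of _ "sys_index M J impulse - 1"]) (rule feasible[OF impulse])
  then have "M - 1 \<le> min_delays (perfect_reconstruction M J impulse)"
    using perfect_reconstruction_impulse pos by blast
  \<comment> \<open>The minimum is squeezed: it is at least \<open>M - 1\<close> and at most \<mu> -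
    1, while \<mu> is at most \<open>M\<close>.\<close>
  then have tight: "min_delays (perfect_reconstruction M J impulse) = sys_index M J impulse - 1"
    using upper[OF impulse] sys_index_le[of M J impulse] by linarith
  \<comment> \<open>The state dimension \<open>J * M\<close> is at least \<open>M\<close>, so enough
    blocks are present.\<close>
  have "output_controllable (sys_A M J) (sys_B M J) (sys_C M J x)" for x
    using oc_mat_full_rank[of M "J * M" J x] sys_A_carrier[of M J] sys_C_carrier[of M J x] pos
    by (simp add: output_controllable_def)
  then show ?thesis
    using feasible upper impulse tight mat_rank_sys_C mat_rank_sys_C' sys_index_pos
    unfolding equiv by blast
qed

end
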